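(* Let $K\subset L$ be a separable field extension and let $A$ and $B$ be two $n$-dimensional $K$-subspaces of $L$ with $n\geq 1$, where $B$ is a primitive $K$-subspace of $L$, i.e. $K(b)=L$ for every $b\in B\setminus\{0\}$. Then $A$ is matched to $B$.
   Context: Let $K\subset L$ be a field extension and $A,B$ two $n$-dimensional $K$-subspaces of $L$. A basis $\mathcal A=\{a_1,\ldots,a_n\}$ of $A$ is matched to a basis $\mathcal B=\{b_1,\ldots,b_n\}$ of $B$ if for all $b\in B$ and all $i=1,\ldots,n$: $a_ib\in A$ implies $b\in\langle b_1,\ldots,\hat b_i,\ldots,b_n\rangle$, the $K$-span of $\mathcal B\setminus\{b_i\}$. The subspace $A$ is matched to $B$ if every basis of $A$ can be matched to some basis of $B$. *)

theory Defs
  imports "HOL-Algebra.Algebra"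
begin

text \<open>
  A field extension is a field \<open>L\<close> with a distinguished \<open>subfield K L\<close>; linear algebra over \<open>K\<close>
  inside \<open>L\<close> is that of \<^theory>\<open>HOL-Algebra.Embedded_Algebras\<close>. There \<open>dimension n K E\<close> entails
  that \<open>E\<close> is a \<open>K\<close>-subspace of \<open>L\<close> (see \<open>dimension_is_subalgebra\<close>).
\<close>

text \<open>
  A polynomial over a field is separable if it has no multiple root in an algebraic closure.
  For \<open>p\<close> with coefficients in a subfield \<open>K\<close> we use an algebraic closure of the
  big field, which contains one of \<open>K\<close>; \<open>indexed_const\<close> is the embedding into it.
\<close>

definition (in field) separable_poly :: "'a list \<Rightarrow> bool"
  where "separable_poly p \<longleftrightarrow>
    (\<forall>x \<in> carrier alg_closure.
       ring.is_root alg_closure (map indexed_const p) x \<longrightarrow>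
       ring.alg_mult alg_closure (map indexed_const p) x = 1)"

definition (in field) separable_extension :: "'a set \<Rightarrow> bool"
  where "separable_extension K \<longleftrightarrow>
    (\<forall>x \<in> carrier R. (algebraic over K) x \<and> separable_poly (Irr K x))"

text \<open>
  \<open>generate_field R (insert b K)\<close> is the simple field extension \<open>K(b)\<close>. (The library's
  \<open>simple_extension K b\<close> is only the ring \<open>K[b]\<close>.)
\<close>

definition (in ring) primitive_subspace :: "'a set \<Rightarrow> 'a set \<Rightarrow> bool"
  where "primitive_subspace K B \<longleftrightarrow>
    (\<forall>b \<in> B - {\<zero>}. generate_field R (insert b K) = carrier R)"

text \<open>
  Pitfall: if \<open>K = L\<close> then \<open>L\<close> is itself a primitive subspace, and it is not matched to itself.
  Matching into a primitive subspace is only of interest for proper extensions \<open>K \<subset> carrier L\<close>.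
\<close>

text \<open>Bases are ordered: \<open>a\<^sub>1, \<dots>, a\<^sub>n\<close> is the list \<open>as\<close>, with \<open>a\<^sub>i\<close> stored at position \<open>i - 1\<close>.\<close>

definition (in ring) basis_of :: "'a set \<Rightarrow> 'a set \<Rightarrow> 'a list \<Rightarrow> bool"
  where "basis_of K E us \<longleftrightarrow> set us \<subseteq> carrier R \<and> independent K us \<and> Span K us = E"

definition (in ring) matched_basis ::
    "'a set \<Rightarrow> 'a set \<Rightarrow> 'a set \<Rightarrow> 'a list \<Rightarrow> 'a list \<Rightarrow> bool"
  where "matched_basis K A B as bs \<longleftrightarrow>
    length as = length bs \<and>
    (\<forall>b \<in> B. \<forall>i < length as.
       as ! i \<otimes> b \<in> A \<longrightarrow> b \<in> Span K (take i bs @ drop (Suc i) bs))"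

definition (in ring) matched_subspace :: "'a set \<Rightarrow> 'a set \<Rightarrow> 'a set \<Rightarrow> bool"
  where "matched_subspace K A B \<longleftrightarrow>
    (\<forall>as. basis_of K A as \<longrightarrow> (\<exists>bs. basis_of K B bs \<and> matched_basis K A B as bs))"

end

theory Submission
  imports Defs
begin

text \<open>
  Let \<open>a\<^sub>1, \<dots>, a\<^sub>n\<close> be a basis of \<open>A\<close> and \<open>V\<^sub>i = {b \<in> B. a\<^sub>i b \<in> A}\<close>. A matched basis of \<open>B\<close>
  amounts to hyperplanes \<open>H\<^sub>i \<supseteq> V\<^sub>i\<close> of \<open>B\<close> with zero intersection: take \<open>b\<^sub>i \<noteq> 0\<close> in the
  intersection of the \<open>H\<^sub>j\<close> with \<open>j \<noteq> i\<close>. By a linear version of Hall's theorem they exist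
  if \<open>|J| + dim T \<le> n\<close> for every set \<open>J\<close> of indices, \<open>T\<close> being the intersection of the \<open>V\<^sub>i\<close>
  with \<open>i \<in> J\<close>. If \<open>P\<close> is the span of the \<open>a\<^sub>i\<close> with \<open>i \<in> J\<close> and \<open>S = K \<oplus> T\<close>, then \<open>PS \<subseteq> A \<noteq> L\<close>,
  and the isoperimetric method yields an intermediate field \<open>H\<close> with
  \<open>dim PS - dim P \<ge> dim HS - dim H\<close> and \<open>HS \<noteq> L\<close>. As \<open>B\<close> is primitive, \<open>H\<close> meets \<open>T\<close> trivially,
  so \<open>dim HS - dim H \<ge> dim T\<close>. Since \<open>L = K(b)\<close> with \<open>b\<close> algebraic, all dimensions are finite.
\<close>

section \<open>Subspaces of a finite extension and their dimensions\<close>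

locale finite_field_extension = field R for K and R (structure) +
  assumes subfield_K: "subfield K R"
    and finite_dimension_carrier: "finite_dimension K (carrier R)"
begin

abbreviation subspace :: "'a set \<Rightarrow> bool"
  where "subspace V \<equiv> subalgebra K V R"

abbreviation vdim :: "'a set \<Rightarrow> nat"
  where "vdim V \<equiv> dim K V"

lemma K_subset: "K \<subseteq> carrier R"
  by (rule subfieldE(3)[OF subfield_K])

declare Span.simps [simp del]

lemma Span_Nil [simp]: "Span K [] = {\<zero>}"
  and Span_Cons [simp]: "Span K (v # vs) = line_extension K v (Span K vs)"
  by (simp_all add: Span.simps)

lemma subspaceI:
  assumes "V \<subseteq> carrier R" "\<zero> \<in> V"
    and add: "\<And>v w. v \<in> V \<Longrightarrow> w \<in> V \<Longrightarrow> v \<oplus> w \<in> V"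
    and smult: "\<And>k v. k \<in> K \<Longrightarrow> v \<in> V \<Longrightarrow> k \<otimes> v \<in> V"
  shows "subspace V"
proof -
  have "\<ominus> v \<in> V" if "v \<in> V" for v
  proof -
    have "\<ominus> \<one> \<in> K"
      using subringE(3,5)[OF subfieldE(1)[OF subfield_K]] by blast
    then have "(\<ominus> \<one>) \<otimes> v \<in> V"
      using smult that by blast
    then show ?thesis
      using assms(1) that by (simp add: l_minus subset_iff)
  qed
  then have "subgroup V (add_monoid R)"
    using assms by (intro add.subgroupI) (auto simp flip: a_inv_def)
  then show ?thesis
    using smult by (simp add: subalgebra_def subalgebra_axioms_def)
qed

lemma subspaceD:
  assumes "subspace V"
  shows "V \<subseteq> carrier R" "\<zero> \<in> V"
    and "\<And>v w. v \<in> V \<Longrightarrow> w \<in> V \<Longrightarrow> v \<oplus> w \<in> V"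
    and "\<And>k v. k \<in> K \<Longrightarrow> v \<in> V \<Longrightarrow> k \<otimes> v \<in> V"
  using subalgebra_in_carrier[OF assms] subgroup.one_closed[of V "add_monoid R"]
    subgroup.m_closed[of V "add_monoid R"] assms
  by (auto simp: subalgebra_def subalgebra_axioms_def)

lemma subspace_carrier [simp]: "subspace (carrier R)"
  by (rule carrier_is_subalgebra[OF K_subset])

lemma subspace_finite: "subspace V \<Longrightarrow> finite_dimension K V"
  using subalbegra_incl_imp_finite_dimension[OF subfield_K finite_dimension_carrier]
    subalgebra_in_carrier by blast

lemma dimension_vdim: "subspace V \<Longrightarrow> dimension (vdim V) K V"
  using finite_dimensionE[OF subfield_K subspace_finite] by (simp add: over_def)

lemma vdimI: "dimension n K V \<Longrightarrow> vdim V = n"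
  using dimI[OF subfield_K] by (simp add: over_def)

lemma subspace_dimension: "dimension n K V \<Longrightarrow> subspace V"
  using finite_dimension_imp_subalgebra[OF subfield_K] finite_dimensionI by blast

lemma subspace_basis:
  assumes "subspace V"
  shows "\<exists>vs. set vs \<subseteq> V \<and> independent K vs \<and> length vs = vdim V \<and> Span K vs = V"
proof -
  obtain vs where vs: "set vs \<subseteq> carrier R" "independent K vs" "length vs = vdim V" "Span K vs = V"
    using exists_base[OF subfield_K dimension_vdim[OF assms]] by blast
  then show ?thesis
    using Span_base_incl[OF subfield_K vs(1)] by blast
qed

lemma vdim_mono:
  assumes "subspace V" "subspace W" "V \<subseteq> W"
  shows "vdim V \<le> vdim W"
proof -
  obtain vs where vs: "set vs \<subseteq> V" "independent K vs" "length vs = vdim V" "Span K vs = V"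
    using subspace_basis[OF assms(1)] by blast
  have "set vs \<subseteq> W"
    using vs(1) assms(3) by (rule subset_trans)
  then show ?thesis
    using independent_length_le_dimension[OF subfield_K dimension_vdim[OF assms(2)] vs(2)] vs(3) by simp
qed

lemma subspace_eqI:
  assumes "subspace V" "subspace W" "V \<subseteq> W" "vdim W \<le> vdim V"
  shows "V = W"
proof -
  obtain vs where vs: "set vs \<subseteq> V" "independent K vs" "length vs = vdim V" "Span K vs = V"
    using subspace_basis[OF assms(1)] by blast
  have "set vs \<subseteq> W"
    using vs(1) assms(3) by (rule subset_trans)
  then show ?thesis
    using independent_length_eq_dimension[OF subfield_K dimension_vdim[OF assms(2)] vs(2)] vs(3,4)
      assms(4) vdim_mono[OF assms(1-3)] by simp
qed

lemma subspace_zero [simp]: "subspace {\<zero>}"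
  by (rule subspace_dimension[OF zero_dim])

lemma vdim_zero [simp]: "vdim {\<zero>} = 0"
  by (rule vdimI[OF zero_dim])

lemma vdim_pos_iff:
  assumes "subspace V"
  shows "0 < vdim V \<longleftrightarrow> V \<noteq> {\<zero>}"
  using subspace_eqI[OF subspace_zero assms] subspaceD(2)[OF assms] by fastforce

lemma vdim_less_carrier:
  assumes "subspace V" "V \<noteq> carrier R"
  shows "vdim V < vdim (carrier R)"
  using subspace_eqI[OF assms(1) subspace_carrier] subspaceD(1)[OF assms(1)] assms(2) by fastforce

lemma mem_sum_iff: "x \<in> V <+>\<^bsub>R\<^esub> W \<longleftrightarrow> (\<exists>v\<in>V. \<exists>w\<in>W. x = v \<oplus> w)"
  by (auto simp: set_add_def')

lemma subspace_sum:
  assumes "subspace V" "subspace W"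
  shows "subspace (V <+>\<^bsub>R\<^esub> W)"
  using sum_space_dim(1)[OF subfield_K subspace_finite subspace_finite, OF assms]
    finite_dimension_imp_subalgebra[OF subfield_K] by blast

lemma subset_sum:
  assumes "subspace V" "subspace W"
  shows "V \<subseteq> V <+>\<^bsub>R\<^esub> W" "W \<subseteq> V <+>\<^bsub>R\<^esub> W"
proof -
  show "V \<subseteq> V <+>\<^bsub>R\<^esub> W"
  proof
    fix v assume "v \<in> V"
    moreover from this have "v = v \<oplus> \<zero>" using subspaceD(1)[OF assms(1)] by auto
    ultimately show "v \<in> V <+>\<^bsub>R\<^esub> W" using subspaceD(2)[OF assms(2)] by (metis mem_sum_iff)
  qed
  show "W \<subseteq> V <+>\<^bsub>R\<^esub> W"
  proof
    fix v assume "v \<in> W"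
    moreover from this have "v = \<zero> \<oplus> v" using subspaceD(1)[OF assms(2)] by auto
    ultimately show "v \<in> V <+>\<^bsub>R\<^esub> W" using subspaceD(2)[OF assms(1)] by (metis mem_sum_iff)
  qed
qed

lemma sum_least:
  assumes "subspace Z" "V \<subseteq> Z" "W \<subseteq> Z"
  shows "V <+>\<^bsub>R\<^esub> W \<subseteq> Z"
proof
  fix x assume "x \<in> V <+>\<^bsub>R\<^esub> W"
  then obtain v w where "v \<in> V" "w \<in> W" "x = v \<oplus> w" by (auto simp: mem_sum_iff)
  then show "x \<in> Z" using subspaceD(3)[OF assms(1), of v w] assms(2,3) by auto
qed

lemma vdim_modular:
  assumes "subspace V" "subspace W"
  shows "vdim (V <+>\<^bsub>R\<^esub> W) + vdim (V \<inter> W) = vdim V + vdim W"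
proof -
  have "vdim (V <+>\<^bsub>R\<^esub> W) = vdim V + vdim W - vdim (V \<inter> W)"
    using sum_space_dim(2)[OF subfield_K subspace_finite subspace_finite, OF assms]
    by (simp add: over_def)
  \<comment> \<open>Rules out truncation in the subtraction of natural numbers, so that the formula
    can be stated additively.\<close>
  moreover have "vdim (V \<inter> W) \<le> vdim V"
    using assms by (intro vdim_mono subalgebra_inter) auto
  ultimately show ?thesis by simp
qed

lemma vdim_inter_ge:
  assumes "subspace V" "subspace W" "subspace Z" "V \<subseteq> Z" "W \<subseteq> Z"
  shows "vdim V + vdim W \<le> vdim (V \<inter> W) + vdim Z"
  using vdim_modular[OF assms(1,2)] vdim_mono[OF subspace_sum[OF assms(1,2)] assms(3)]
    sum_least[OF assms(3-5)] by simp

text \<open>The factor \<open>B\<close> keeps the claim meaningful for empty \<open>J\<close>, where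
  the bare intersection would be the whole type.\<close>

lemma subspace_INT:
  assumes "subspace B" "\<And>i. i \<in> J \<Longrightarrow> subspace (V i)"
  shows "subspace (B \<inter> (\<Inter>i\<in>J. V i))"
  using subspaceD[OF assms(1)] subspaceD(2-4)[OF assms(2)]
  by (intro subspaceI) auto

text \<open>A basis of \<open>W\<close> is completed to a basis of the whole field, and the added
  vectors span the complement.\<close>

lemma subspace_complement:
  assumes "subspace W"
  obtains W' where "subspace W'" "W \<inter> W' = {\<zero>}" "W <+>\<^bsub>R\<^esub> W' = carrier R"
    "vdim W + vdim W' = vdim (carrier R)"
proof -
  obtain vs where vs: "set vs \<subseteq> W" "independent K vs" "length vs = vdim W" "Span K vs = W"
    using subspace_basis[OF assms] by blast
  have "set vs \<subseteq> carrier R"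
    using subspaceD(1)[OF assms] vs(1) by (rule subset_trans[rotated])
  then obtain us where us: "independent K (us @ vs)" "Span K (us @ vs) = carrier R"
    using complete_base[OF subfield_K dimension_vdim[OF subspace_carrier] vs(2)] by metis
  have car: "set us \<subseteq> carrier R" "set vs \<subseteq> carrier R"
    using independent_in_carrier[OF us(1)] by auto
  have U: "subspace (Span K us)"
    using Span_is_subalgebra[OF subfield_K car(1)] .
  have int: "W \<inter> Span K us = {\<zero>}"
    using independent_split(3)[OF subfield_K us(1)] vs(4) by (metis Int_commute)
  have "Span K us <+>\<^bsub>R\<^esub> W = carrier R"
    using us(2) vs(4) Span_append_eq_set_add[OF subfield_K car] by metis
  then have "carrier R \<subseteq> W <+>\<^bsub>R\<^esub> Span K us"
    using sum_least[OF subspace_sum[OF assms U] subset_sum(2,1)[OF assms U]] by metis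
  then have sum: "W <+>\<^bsub>R\<^esub> Span K us = carrier R"
    using subspaceD(1)[OF subspace_sum[OF assms U]] by (rule subset_antisym[rotated])
  have "vdim W + vdim (Span K us) = vdim (carrier R)"
    using vdim_modular[OF assms U] unfolding int sum by simp
  then show thesis
    by (rule that[OF U int sum])
qed

section \<open>Scaling of subspaces by field elements\<close>

lemma line_extension_eq_image: "line_extension K a E = (\<lambda>(k, e). k \<otimes> a \<oplus> e) ` (K \<times> E)"
  unfolding Set.set_eq_iff line_extension_mem_iff image_iff by auto

text \<open>Multiplication by \<open>c\<close> is \<open>K\<close>-linear, so it commutes with
  forming spans. Applied to a basis, this controls the image of any subspace.\<close>

lemma Span_smult:
  assumes "c \<in> carrier R" "set vs \<subseteq> carrier R"
  shows "Span K (map ((\<otimes>) c) vs) = (\<otimes>) c ` Span K vs"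
  using assms(2)
proof (induction vs)
  case Nil
  then show ?case using assms(1) by simp
next
  case (Cons v vs)
  then have v: "v \<in> carrier R" "set vs \<subseteq> carrier R" by auto
  have *: "c \<otimes> (k \<otimes> v \<oplus> e) = k \<otimes> (c \<otimes> v) \<oplus> c \<otimes> e" if "k \<in> K" "e \<in> Span K vs" for k e
    using subsetD[OF K_subset that(1)] subsetD[OF Span_in_carrier[OF K_subset v(2)] that(2)] v(1) assms(1)
    by (simp add: r_distr m_lcomm)
  have "(\<otimes>) c ` Span K (v # vs) = (\<lambda>(k, e). k \<otimes> (c \<otimes> v) \<oplus> c \<otimes> e) ` (K \<times> Span K vs)"
    unfolding Span_Cons line_extension_eq_image image_image
    by (rule image_cong) (use * in auto)
  also have "\<dots> = (\<lambda>(k, e). k \<otimes> (c \<otimes> v) \<oplus> e) ` (map_prod (\<lambda>k. k) ((\<otimes>) c) ` (K \<times> Span K vs))"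
    unfolding image_image by (rule image_cong) auto
  also have "map_prod (\<lambda>k. k) ((\<otimes>) c) ` (K \<times> Span K vs) = K \<times> (\<otimes>) c ` Span K vs"
    by (simp add: map_prod_surj_on[OF image_ident refl])
  finally show ?case
    using Cons.IH[OF v(2)] by (simp add: line_extension_eq_image)
qed

lemma inv_nonzero [simp]:
  assumes "c \<in> carrier R" "c \<noteq> \<zero>"
  shows "inv c \<in> carrier R" "inv c \<noteq> \<zero>"
proof -
  have c: "c \<in> Units R" using assms field_Units by auto
  then show "inv c \<in> carrier R" by simp
  show "inv c \<noteq> \<zero>" using Units_inv_Units[OF c] field_Units by auto
qed

lemma inv_mult_cancel [simp]:
  assumes "c \<in> carrier R" "c \<noteq> \<zero>" "x \<in> carrier R"
  shows "inv c \<otimes> (c \<otimes> x) = x" "c \<otimes> (inv c \<otimes> x) = x"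
proof -
  have c: "c \<in> Units R" using assms field_Units by auto
  show "inv c \<otimes> (c \<otimes> x) = x" using c assms by (simp flip: m_assoc)
  show "c \<otimes> (inv c \<otimes> x) = x" using c assms by (simp flip: m_assoc)
qed

lemma smult_inv_image [simp]:
  assumes "c \<in> carrier R" "c \<noteq> \<zero>" "V \<subseteq> carrier R"
  shows "(\<otimes>) (inv c) ` (\<otimes>) c ` V = V" "(\<otimes>) c ` (\<otimes>) (inv c) ` V = V"
  using assms by (force simp: image_iff subset_iff)+

lemma smult_zero_iff:
  assumes "c \<in> carrier R" "c \<noteq> \<zero>" "V \<subseteq> carrier R"
  shows "(\<otimes>) c ` V = {\<zero>} \<longleftrightarrow> V = {\<zero>}"
  using smult_inv_image(1)[OF assms] inv_nonzero(1)[OF assms(1,2)] assms(1)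
  by (metis image_empty image_insert r_null)

lemma subspace_smult:
  assumes "subspace V" "c \<in> carrier R"
  shows "subspace ((\<otimes>) c ` V)"
proof -
  obtain vs where vs: "set vs \<subseteq> V" "independent K vs" "length vs = vdim V" "Span K vs = V"
    using subspace_basis[OF assms(1)] by blast
  have vc: "set vs \<subseteq> carrier R"
    using vs(1) subspaceD(1)[OF assms(1)] by (rule subset_trans)
  have map: "set (map ((\<otimes>) c) vs) \<subseteq> carrier R"
    using subsetD[OF vc] assms(2) by auto
  have eq: "(\<otimes>) c ` V = Span K (map ((\<otimes>) c) vs)"
    using Span_smult[OF assms(2) vc] vs by simp
  show ?thesis
    unfolding eq by (rule Span_is_subalgebra[OF subfield_K map])
qed

lemma vdim_Span_le:
  assumes "set vs \<subseteq> carrier R"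
  shows "vdim (Span K vs) \<le> length vs"
  using assms
proof (induction vs)
  case Nil
  then show ?case by simp
next
  case (Cons v vs)
  then have v: "v \<in> carrier R" "set vs \<subseteq> carrier R" by auto
  note sub = Span_is_subalgebra[OF subfield_K v(2)] Span_is_subalgebra[OF subfield_K Cons.prems]
  show ?case
  proof (cases "v \<in> Span K vs")
    case True
    then have "Span K (v # vs) \<subseteq> Span K vs"
      using Span_base_incl[OF subfield_K v(2)]
      by (intro mono_Span_subset[OF subfield_K _ v(2)]) simp
    then have "vdim (Span K (v # vs)) \<le> vdim (Span K vs)"
      by (rule vdim_mono[OF sub(2,1)])
    then show ?thesis
      using Cons.IH[OF v(2)] by simp
  next
    case False
    have "vdim (Span K (v # vs)) = Suc (vdim (Span K vs))"
      unfolding Span_Cons by (rule vdimI[OF Suc_dim[OF v(1) False dimension_vdim[OF sub(1)]]])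
    then show ?thesis using Cons.IH[OF v(2)] by simp
  qed
qed

lemma vdim_smult_le:
  assumes "subspace V" "c \<in> carrier R"
  shows "vdim ((\<otimes>) c ` V) \<le> vdim V"
proof -
  obtain vs where vs: "set vs \<subseteq> V" "independent K vs" "length vs = vdim V" "Span K vs = V"
    using subspace_basis[OF assms(1)] by blast
  have vc: "set vs \<subseteq> carrier R"
    using vs(1) subspaceD(1)[OF assms(1)] by (rule subset_trans)
  have map: "set (map ((\<otimes>) c) vs) \<subseteq> carrier R"
    using subsetD[OF vc] assms(2) by auto
  have eq: "(\<otimes>) c ` V = Span K (map ((\<otimes>) c) vs)"
    using Span_smult[OF assms(2) vc] vs by simp
  show ?thesis
    using vdim_Span_le[OF map] vs(3) unfolding eq by simp
qed

text \<open>Scaling cannot raise the dimension, and scaling by \<open>inv c\<close> undoes scaling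
  by \<open>c\<close>.\<close>

lemma vdim_smult:
  assumes "subspace V" "c \<in> carrier R" "c \<noteq> \<zero>"
  shows "vdim ((\<otimes>) c ` V) = vdim V"
  using vdim_smult_le[OF assms(1,2)]
    vdim_smult_le[OF subspace_smult[OF assms(1,2)] inv_nonzero(1)[OF assms(2,3)]]
    smult_inv_image(1)[OF assms(2,3) subspaceD(1)[OF assms(1)]] by simp

section \<open>The space \<open>PS\<close> spanned by the products of two sets\<close>

definition span_mult :: "'a set \<Rightarrow> 'a set \<Rightarrow> 'a set"
  where "span_mult P S = \<Inter>{Z. subspace Z \<and> (\<forall>x\<in>P. \<forall>s\<in>S. x \<otimes> s \<in> Z)}"

lemma span_mult_least:
  assumes "subspace Z" "\<And>x s. x \<in> P \<Longrightarrow> s \<in> S \<Longrightarrow> x \<otimes> s \<in> Z"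
  shows "span_mult P S \<subseteq> Z"
  using assms unfolding span_mult_def by blast

lemma mem_span_mult: "x \<in> P \<Longrightarrow> s \<in> S \<Longrightarrow> x \<otimes> s \<in> span_mult P S"
  unfolding span_mult_def by blast

lemma subspace_span_mult:
  assumes "P \<subseteq> carrier R" "S \<subseteq> carrier R"
  shows "subspace (span_mult P S)"
proof -
  let ?F = "{Z. subspace Z \<and> (\<forall>x\<in>P. \<forall>s\<in>S. x \<otimes> s \<in> Z)}"
  \<comment> \<open>The whole field is one of the subspaces intersected, which brings the
    intersection into the form treated by \<open>subspace_INT\<close>.\<close>
  have "carrier R \<in> ?F" using assms by auto
  then have "span_mult P S = carrier R \<inter> (\<Inter>Z\<in>?F. Z)"
    unfolding span_mult_def by auto
  then show ?thesis
    using subspace_INT[of "carrier R" ?F "\<lambda>Z. Z"] by auto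
qed

lemma span_mult_mono:
  assumes "P \<subseteq> Q" "Q \<subseteq> carrier R" "S \<subseteq> carrier R"
  shows "span_mult P S \<subseteq> span_mult Q S"
  using assms by (intro span_mult_least subspace_span_mult mem_span_mult) auto

lemma span_mult_incl:
  assumes "P \<subseteq> carrier R" "S \<subseteq> carrier R" "\<one> \<in> S"
  shows "P \<subseteq> span_mult P S"
  using mem_span_mult[of _ P \<one> S] assms by (metis r_one subset_iff)

lemma span_mult_smult_subset:
  assumes "c \<in> carrier R" "P \<subseteq> carrier R" "S \<subseteq> carrier R"
  shows "span_mult ((\<otimes>) c ` P) S \<subseteq> (\<otimes>) c ` span_mult P S"
proof (rule span_mult_least)
  show "subspace ((\<otimes>) c ` span_mult P S)"
    by (intro subspace_smult subspace_span_mult assms)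
  fix y s assume "y \<in> (\<otimes>) c ` P" and s: "s \<in> S"
  then obtain x where x: "x \<in> P" "y = c \<otimes> x" by auto
  then have "y \<otimes> s = c \<otimes> (x \<otimes> s)" using assms s by (simp add: m_assoc subset_iff)
  then show "y \<otimes> s \<in> (\<otimes>) c ` span_mult P S" using mem_span_mult x s by auto
qed

text \<open>The inclusion just proved, applied to \<open>inv c\<close> and the scaled set, gives the
  reverse one.\<close>

lemma span_mult_smult:
  assumes "c \<in> carrier R" "c \<noteq> \<zero>" "P \<subseteq> carrier R" "S \<subseteq> carrier R"
  shows "span_mult ((\<otimes>) c ` P) S = (\<otimes>) c ` span_mult P S"
proof
  show "span_mult ((\<otimes>) c ` P) S \<subseteq> (\<otimes>) c ` span_mult P S"
    using span_mult_smult_subset assms by blast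
  have inv: "inv c \<in> carrier R" "(\<otimes>) c ` P \<subseteq> carrier R"
    using assms by auto
  have "span_mult P S \<subseteq> (\<otimes>) (inv c) ` span_mult ((\<otimes>) c ` P) S"
    using span_mult_smult_subset[OF inv assms(4)] assms by simp
  then have "(\<otimes>) c ` span_mult P S \<subseteq> (\<otimes>) c ` (\<otimes>) (inv c) ` span_mult ((\<otimes>) c ` P) S"
    by (rule image_mono)
  then show "(\<otimes>) c ` span_mult P S \<subseteq> span_mult ((\<otimes>) c ` P) S"
    using smult_inv_image(2)[OF assms(1,2) subspaceD(1)[OF subspace_span_mult[OF inv(2) assms(4)]]]
    by simp
qed

section \<open>Hyperplanes and duality for the multiplication form\<close>

lemma hyperplane_exists:
  obtains \<Lambda> where "subspace \<Lambda>" "vdim \<Lambda> + 1 = vdim (carrier R)"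
proof -
  have "carrier R \<noteq> {\<zero>}"
    using one_closed one_not_zero by (metis singletonD)
  then have "vdim (carrier R) \<noteq> 0"
    using vdim_pos_iff[OF subspace_carrier] by simp
  then obtain n where n: "vdim (carrier R) = Suc n" using not0_implies_Suc by blast
  then have "dimension (Suc n) K (carrier R)"
    using dimension_vdim[OF subspace_carrier] by simp
  then obtain E where "dimension n K E"
    using dimension_backwards[OF subfield_K] by blast
  then show thesis using that[of E] subspace_dimension[of n E] vdimI[of n E] n by simp
qed

text \<open>
  If \<open>\<Lambda>\<close> is the kernel of a functional \<open>\<phi>\<close>, then \<open>dual \<Lambda> W\<close> is the orthogonal complement
  of \<open>W\<close> with respect to the nondegenerate form \<open>\<phi>(xy)\<close>.
\<close>

definition dual :: "'a set \<Rightarrow> 'a set \<Rightarrow> 'a set"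
  where "dual \<Lambda> W = {y \<in> carrier R. \<forall>w\<in>W. y \<otimes> w \<in> \<Lambda>}"

lemma subspace_dual:
  assumes "subspace \<Lambda>" "W \<subseteq> carrier R"
  shows "subspace (dual \<Lambda> W)"
proof (rule subspaceI)
  fix k v assume k: "k \<in> K" and v: "v \<in> dual \<Lambda> W"
  then have car: "k \<in> carrier R" "v \<in> carrier R" using K_subset by (auto simp: dual_def)
  have "k \<otimes> v \<otimes> w \<in> \<Lambda>" if "w \<in> W" for w
  proof -
    have "k \<otimes> v \<otimes> w = k \<otimes> (v \<otimes> w)" using car that assms(2) by (simp add: m_assoc subset_iff)
    then show ?thesis using subspaceD(4)[OF assms(1) k] v that by (simp add: dual_def)
  qed
  then show "k \<otimes> v \<in> dual \<Lambda> W" using car by (simp add: dual_def)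
qed (use assms(2) subspaceD(2,3)[OF assms(1)] in \<open>auto simp: dual_def l_distr subset_iff\<close>)

context
  fixes \<Lambda> assumes \<Lambda>: "subspace \<Lambda>" "vdim \<Lambda> + 1 = vdim (carrier R)"
begin

text \<open>Nondegeneracy of the form: multiplication by a nonzero \<open>y\<close> is onto, so such
  a \<open>y\<close> in the dual would force \<open>\<Lambda>\<close> to be the whole field.\<close>

lemma dual_carrier: "dual \<Lambda> (carrier R) = {\<zero>}"
proof -
  have "y = \<zero>" if y: "y \<in> dual \<Lambda> (carrier R)" for y
  proof (rule ccontr)
    assume "y \<noteq> \<zero>"
    then have "z \<in> \<Lambda>" if "z \<in> carrier R" for z
      using inv_mult_cancel(2)[of y z] inv_nonzero(1)[of y] y that unfolding dual_def by (metis (no_types, lifting) m_closed mem_Collect_eq)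
    then have "\<Lambda> = carrier R" using subspaceD(1)[OF \<Lambda>(1)] by blast
    then show False using \<Lambda>(2) by simp
  qed
  then show ?thesis using subspaceD(2)[OF subspace_dual[OF \<Lambda>(1) subset_refl]] by blast
qed

text \<open>Each generator imposes at most one linear condition on the dual and so lowers its
  dimension by at most one.\<close>

lemma vdim_dual_Span:
  assumes "set vs \<subseteq> carrier R"
  shows "vdim (carrier R) \<le> vdim (dual \<Lambda> (Span K vs)) + length vs"
  using assms
proof (induction vs)
  case Nil
  have "dual \<Lambda> {\<zero>} = carrier R"
    using subspaceD(2)[OF \<Lambda>(1)] by (auto simp: dual_def)
  then show ?case by simp
next
  case (Cons v vs)
  then have v: "v \<in> carrier R" and vs: "set vs \<subseteq> carrier R" by auto
  show ?case
  proof (cases "v = \<zero>")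
    case True
    have "Span K (v # vs) \<subseteq> Span K vs"
      using True mono_Span_subset[OF subfield_K, of "v # vs" vs] Span_base_incl[OF subfield_K vs]
        Span_subgroup_props(2)[OF subfield_K vs] vs by simp
    then have "dual \<Lambda> (Span K vs) \<subseteq> dual \<Lambda> (Span K (v # vs))"
      by (auto simp: dual_def)
    then have "vdim (dual \<Lambda> (Span K vs)) \<le> vdim (dual \<Lambda> (Span K (v # vs)))"
      by (intro vdim_mono subspace_dual \<Lambda> Span_in_carrier[OF K_subset] vs Cons.prems)
    then show ?thesis using Cons.IH[OF vs] by simp
  next
    case False
    \<comment> \<open>This is the hyperplane of all \<open>y\<close> with
      \<open>y \<otimes> v \<in> \<Lambda>\<close>.\<close>
    define H where "H = (\<otimes>) (inv v) ` \<Lambda>"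
    note iv = inv_nonzero[OF v False]
    have H: "subspace H" "vdim H + 1 = vdim (carrier R)"
      using iv \<Lambda> by (auto simp: H_def subspace_smult vdim_smult)
    have D: "subspace (dual \<Lambda> (Span K vs))"
      using Span_in_carrier[OF K_subset vs] \<Lambda>(1) subspace_dual by blast
    have "dual \<Lambda> (Span K vs) \<inter> H \<subseteq> dual \<Lambda> (Span K (v # vs))"
    proof
      fix y assume y: "y \<in> dual \<Lambda> (Span K vs) \<inter> H"
      then obtain l where l: "l \<in> \<Lambda>" "y = inv v \<otimes> l" by (auto simp: H_def)
      have yc: "y \<in> carrier R" using y by (auto simp: dual_def)
      have lc: "l \<in> carrier R" using l subspaceD(1)[OF \<Lambda>(1)] by auto
      have yv: "y \<otimes> v \<in> \<Lambda>"
        using l inv_mult_cancel(2)[OF v False lc] iv(1) v lc by (simp add: m_comm)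
      have "y \<otimes> (k \<otimes> v \<oplus> e) \<in> \<Lambda>" if "k \<in> K" "e \<in> Span K vs" for k e
      proof -
        have c: "k \<in> carrier R" "e \<in> carrier R"
          using that K_subset Span_in_carrier[OF K_subset vs] by auto
        have "y \<otimes> (k \<otimes> v \<oplus> e) = k \<otimes> (y \<otimes> v) \<oplus> y \<otimes> e"
          using c yc v by (simp add: r_distr m_lcomm)
        then show ?thesis
          using subspaceD(3,4)[OF \<Lambda>(1)] yv that y by (auto simp: dual_def)
      qed
      then show "y \<in> dual \<Lambda> (Span K (v # vs))"
        using yc by (auto simp: dual_def line_extension_mem_iff)
    qed
    then have "vdim (dual \<Lambda> (Span K vs) \<inter> H) \<le> vdim (dual \<Lambda> (Span K (v # vs)))"
      using Span_in_carrier[OF K_subset Cons.prems]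
      by (intro vdim_mono subspace_dual subalgebra_inter D H \<Lambda>)
    moreover have "vdim (dual \<Lambda> (Span K vs)) + vdim H \<le> vdim (dual \<Lambda> (Span K vs) \<inter> H) + vdim (carrier R)"
      using D H subspaceD(1) by (intro vdim_inter_ge) auto
    ultimately show ?thesis using Cons.IH[OF vs] H(2) by simp
  qed
qed

lemma vdim_dual_ge:
  assumes "subspace W"
  shows "vdim (carrier R) \<le> vdim (dual \<Lambda> W) + vdim W"
proof -
  obtain vs where vs: "set vs \<subseteq> W" "independent K vs" "length vs = vdim W" "Span K vs = W"
    using subspace_basis[OF assms] by blast
  then show ?thesis using vdim_dual_Span[of vs] subspaceD(1)[OF assms] by auto
qed

text \<open>The lower bounds for \<open>W\<close> and for a complement \<open>W'\<close> add up to
  the dimension of the field. The two duals cannot exceed that in total, because they meet in zero.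
  So both bounds are equalities.\<close>

lemma vdim_dual:
  assumes "subspace W"
  shows "vdim (dual \<Lambda> W) + vdim W = vdim (carrier R)"
proof -
  obtain W' where W': "subspace W'" "W <+>\<^bsub>R\<^esub> W' = carrier R" "vdim W + vdim W' = vdim (carrier R)"
    using subspace_complement[OF assms] by metis
  have car: "W \<subseteq> carrier R" "W' \<subseteq> carrier R" using assms W' subspaceD(1) by auto
  have "dual \<Lambda> W \<inter> dual \<Lambda> W' \<subseteq> dual \<Lambda> (carrier R)"
    unfolding W'(2)[symmetric]
    using car subspaceD(3)[OF \<Lambda>(1)] by (auto simp: dual_def mem_sum_iff r_distr subset_iff)
  then have "vdim (dual \<Lambda> W \<inter> dual \<Lambda> W') \<le> vdim {\<zero>}"
    using car dual_carrier by (intro vdim_mono subalgebra_inter subspace_dual \<Lambda>) auto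
  moreover have "vdim (dual \<Lambda> W) + vdim (dual \<Lambda> W') \<le> vdim (dual \<Lambda> W \<inter> dual \<Lambda> W') + vdim (carrier R)"
    using car by (intro vdim_inter_ge subspace_dual \<Lambda>) (auto simp: dual_def)
  ultimately show ?thesis
    using vdim_dual_ge[OF assms] vdim_dual_ge[OF W'(1)] W'(3) by simp
qed

end

section \<open>The isoperimetric method\<close>

lemma subfield_subspace:
  assumes "subfield H R" "K \<subseteq> H"
  shows "subspace H"
  using subringE[OF subfieldE(1)[OF assms(1)]] assms(2) by (intro subspaceI) auto

text \<open>
  Hamidoune's isoperimetric method: among the nonzero subspaces \<open>P\<close> with \<open>PS \<noteq> L\<close> minimising
  \<open>dim PS - dim P\<close>, those of least dimension (the atoms) pairwise meet trivially or coincide,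
  since \<open>dim PS - dim P\<close> is submodular in \<open>P\<close>. Hence the atom containing \<open>1\<close> is
  stable under division by its nonzero elements.
\<close>

lemma atom_subfield:
  assumes S: "subspace S" "\<one> \<in> S"
    and P0: "subspace P0" "P0 \<noteq> {\<zero>}" "span_mult P0 S \<noteq> carrier R"
  shows "\<exists>H. subfield H R \<and> K \<subseteq> H \<and> span_mult H S \<noteq> carrier R \<and>
    vdim (span_mult H S) + vdim P0 \<le> vdim (span_mult P0 S) + vdim H"
proof -
  define N where "N = vdim (carrier R)"
  define F where "F P \<longleftrightarrow> subspace P \<and> P \<noteq> {\<zero>} \<and> span_mult P S \<noteq> carrier R" for P
  define f where "f P = vdim (span_mult P S) - vdim P" for P
  note Sc = subspaceD(1)[OF S(1)]
  have sub: "subspace (span_mult P S)" if "subspace P" for P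
    using subspace_span_mult[OF subspaceD(1)[OF that] Sc] .
  \<comment> \<open>As \<open>\<one> \<in> S\<close>, the space \<open>PS\<close> contains
    \<open>P\<close>, so the truncated subtraction in \<open>f\<close> is exact.\<close>
  have fp: "vdim (span_mult P S) = f P + vdim P" if "subspace P" for P
    using vdim_mono[OF that sub[OF that] span_mult_incl[OF subspaceD(1)[OF that] Sc S(2)]]
    by (simp add: f_def)
  have "F P0" using P0 by (simp add: F_def)
  then obtain M1 where M1: "F M1" "\<And>P. F P \<Longrightarrow> f M1 \<le> f P"
    using ex_has_least_nat[of F P0 f] by blast
  define \<kappa> where "\<kappa> = f M1"
  obtain M where M: "F M" "f M = \<kappa>" "\<And>P. F P \<Longrightarrow> f P = \<kappa> \<Longrightarrow> vdim M \<le> vdim P"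
    using ex_has_least_nat[of "\<lambda>P. F P \<and> f P = \<kappa>" M1 vdim] M1(1) \<kappa>_def by blast
  define m where "m = vdim M"
  define atom where "atom P \<longleftrightarrow> F P \<and> f P = \<kappa> \<and> vdim P = m" for P
  have min_f: "\<kappa> \<le> f P" if "F P" for P using M1 that \<kappa>_def by simp
  have min_d: "m \<le> vdim P" if "F P" "f P = \<kappa>" for P using M that m_def by simp
  have "atom M" using M by (simp add: atom_def m_def)
  have m_pos: "0 < m"
    using M(1) vdim_pos_iff[of M] by (simp add: F_def m_def)
  \<comment> \<open>Multiplication by \<open>c\<close> preserves dimensions and commutes with
    forming \<open>PS\<close>.\<close>
  have atom_smult: "atom ((\<otimes>) c ` P)" if P: "atom P" and c: "c \<in> carrier R" "c \<noteq> \<zero>" for P c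
  proof -
    have P': "subspace P" "P \<noteq> {\<zero>}" "span_mult P S \<noteq> carrier R"
      using P by (auto simp: atom_def F_def)
    note Pc = subspaceD(1)[OF P'(1)]
    have eq: "span_mult ((\<otimes>) c ` P) S = (\<otimes>) c ` span_mult P S"
      by (rule span_mult_smult[OF c Pc Sc])
    have "(\<otimes>) c ` span_mult P S \<noteq> carrier R"
      using vdim_smult[OF sub[OF P'(1)] c] vdim_less_carrier[OF sub[OF P'(1)] P'(3)] by auto
    then have "F ((\<otimes>) c ` P)"
      using subspace_smult[OF P'(1) c(1)] smult_zero_iff[OF c Pc] P'(2) eq by (simp add: F_def)
    moreover have "f ((\<otimes>) c ` P) = f P"
      unfolding f_def eq using vdim_smult[OF sub[OF P'(1)] c] vdim_smult[OF P'(1) c] by simp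
    ultimately show ?thesis
      using P vdim_smult[OF P'(1) c] by (simp add: atom_def)
  qed
  \<comment> \<open>It suffices to show \<open>f I = \<kappa>\<close> for the intersection
    \<open>I\<close>, since \<open>m\<close> is the least dimension of a minimiser. Submodularity
    yields this once the sum \<open>U\<close> satisfies
    \<open>\<kappa> + vdim U \<le> vdim (span_mult U S)\<close>.\<close>
  have atoms_eq: "P = Q" if P: "atom P" and Q: "atom Q" and PQ: "P \<inter> Q \<noteq> {\<zero>}" for P Q
  proof -
    have P': "subspace P" "span_mult P S \<noteq> carrier R" "vdim P = m" "vdim (span_mult P S) = \<kappa> + m"
      and Q': "subspace Q" "vdim Q = m" "vdim (span_mult Q S) = \<kappa> + m"
      using P Q fp by (auto simp: atom_def F_def)
    note Pc = subspaceD(1)[OF P'(1)] and Qc = subspaceD(1)[OF Q'(1)]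
    define I where "I = P \<inter> Q"
    define U where "U = P <+>\<^bsub>R\<^esub> Q"
    have I: "subspace I" and U: "subspace U"
      unfolding I_def U_def by (intro subalgebra_inter subspace_sum P' Q')+
    have dim_UI: "vdim U + vdim I = 2 * m"
      using vdim_modular[OF P'(1) Q'(1)] P'(3) Q'(2) by (simp add: I_def U_def)
    have Isub: "span_mult I S \<subseteq> span_mult P S" "span_mult I S \<subseteq> span_mult Q S"
      unfolding I_def by (rule span_mult_mono[OF Int_lower1 Pc Sc], rule span_mult_mono[OF Int_lower2 Qc Sc])
    have Usub: "span_mult U S \<subseteq> span_mult P S <+>\<^bsub>R\<^esub> span_mult Q S"
    proof (rule span_mult_least)
      show "subspace (span_mult P S <+>\<^bsub>R\<^esub> span_mult Q S)"
        by (intro subspace_sum sub P' Q')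
      fix x s assume "x \<in> U" and s: "s \<in> S"
      then obtain p q where pq: "p \<in> P" "q \<in> Q" "x = p \<oplus> q"
        by (auto simp: U_def mem_sum_iff)
      have "x \<otimes> s = p \<otimes> s \<oplus> q \<otimes> s"
        using pq(3) subsetD[OF Pc pq(1)] subsetD[OF Qc pq(2)] subsetD[OF Sc s] by (simp add: l_distr)
      then show "x \<otimes> s \<in> span_mult P S <+>\<^bsub>R\<^esub> span_mult Q S"
        using mem_span_mult[OF pq(1) s] mem_span_mult[OF pq(2) s] by (metis mem_sum_iff)
    qed
    have submod: "vdim (span_mult I S) + vdim (span_mult U S) \<le> 2 * (\<kappa> + m)"
    proof -
      have "vdim (span_mult I S) \<le> vdim (span_mult P S \<inter> span_mult Q S)"
        using Isub by (intro vdim_mono subalgebra_inter sub I P' Q') auto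
      moreover have "vdim (span_mult U S) \<le> vdim (span_mult P S <+>\<^bsub>R\<^esub> span_mult Q S)"
        by (intro vdim_mono subspace_sum sub U P' Q' Usub)
      ultimately show ?thesis
        using vdim_modular[OF sub[OF P'(1)] sub[OF Q'(1)]] P'(4) Q'(3) by simp
    qed
    have I_pos: "0 < vdim I"
      using vdim_pos_iff[OF I] PQ by (simp add: I_def)
    have "span_mult I S \<noteq> carrier R"
      using Isub(1) P'(2) subspaceD(1)[OF sub[OF P'(1)]] by blast
    then have FI: "F I"
      using I PQ by (simp add: F_def I_def)
    have I_ge: "\<kappa> + vdim I \<le> vdim (span_mult I S)"
      using min_f[OF FI] fp[OF I] by simp
    \<comment> \<open>Minimality of \<open>\<kappa>\<close> excludes this unless \<open>US\<close>
      is the whole field, where \<open>U\<close> is not admissible. In that case the dual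
      \<open>D\<close> of \<open>PS\<close> serves as a further admissible subspace.\<close>
    have U_le: "vdim (span_mult U S) < \<kappa> + vdim U \<Longrightarrow> False"
    proof -
      assume less: "vdim (span_mult U S) < \<kappa> + vdim U"
      have "U \<noteq> {\<zero>}"
        using less vdim_pos_iff[OF U] dim_UI m_pos vdim_mono[OF I P'(1)] P'(3) by (auto simp: I_def)
      then have full: "span_mult U S = carrier R"
        using less min_f[of U] fp[OF U] U by (force simp: F_def)
      obtain \<Lambda> where \<Lambda>: "subspace \<Lambda>" "vdim \<Lambda> + 1 = vdim (carrier R)"
        using hyperplane_exists by metis
      define D where "D = dual \<Lambda> (span_mult P S)"
      have D: "subspace D" "D \<subseteq> carrier R" "vdim D + (\<kappa> + m) = N"
        using vdim_dual[OF \<Lambda> sub[OF P'(1)]] subspace_dual[OF \<Lambda>(1) subspaceD(1)[OF sub[OF P'(1)]]]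
        by (auto simp: D_def N_def P'(4) dual_def)
      have "0 < vdim D"
        using D(3) P'(4) vdim_less_carrier[OF sub[OF P'(1)] P'(2)] by (simp add: N_def)
      have dual_P: "vdim (dual \<Lambda> P) + m = N"
        using vdim_dual[OF \<Lambda> P'(1)] P'(3) by (simp add: N_def)
      \<comment> \<open>The form is associative: if \<open>y\<close> is orthogonal to
        \<open>PS\<close>, then \<open>ys\<close> is orthogonal to \<open>P\<close>.\<close>
      have "span_mult D S \<subseteq> dual \<Lambda> P"
      proof (rule span_mult_least)
        show "subspace (dual \<Lambda> P)" by (rule subspace_dual[OF \<Lambda>(1) Pc])
        fix y s assume y: "y \<in> D" and s: "s \<in> S"
        note yc = subsetD[OF D(2) y] and sc = subsetD[OF Sc s]
        have "y \<otimes> s \<otimes> p \<in> \<Lambda>" if p: "p \<in> P" for p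
        proof -
          have "y \<otimes> s \<otimes> p = y \<otimes> (p \<otimes> s)"
            using yc sc subsetD[OF Pc p] by (simp add: m_ac)
          then show ?thesis
            using y mem_span_mult[OF p s] by (simp add: D_def dual_def)
        qed
        then show "y \<otimes> s \<in> dual \<Lambda> P" using yc sc by (simp add: dual_def)
      qed
      then have DS: "vdim (span_mult D S) \<le> vdim (dual \<Lambda> P)"
        by (intro vdim_mono sub D subspace_dual[OF \<Lambda>(1) Pc])
      then have "vdim (span_mult D S) < N" using dual_P m_pos by simp
      then have FD: "F D"
        using D(1) \<open>0 < vdim D\<close> vdim_pos_iff[OF D(1)] by (auto simp: F_def N_def)
      \<comment> \<open>\<open>DS\<close> has dimension at most \<open>N - m\<close> and
        \<open>D\<close> has dimension \<open>N - (\<kappa> + m)\<close>, so their difference is at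
        most \<open>\<kappa>\<close>.\<close>
      have "f D = \<kappa>"
        using min_f[OF FD] fp[OF D(1)] DS dual_P D(3) by simp
      then have "m \<le> vdim D" by (rule min_d[OF FD])
      \<comment> \<open>The bound on \<open>D\<close> gives \<open>\<kappa> + 2 * m \<le> N\<close>.
        With \<open>US\<close> the whole field, \<open>submod\<close> and \<open>I_ge\<close> give
        \<open>vdim I + N \<le> \<kappa> + 2 * m\<close>, which forces
        \<open>vdim I = 0\<close>.\<close>
      then show False
        using submod I_ge dim_UI I_pos less full D(3) by (simp add: N_def)
    qed
    have fI: "f I = \<kappa>"
      using U_le submod I_ge dim_UI fp[OF I] by force
    have "m \<le> vdim I" by (rule min_d[OF FI fI])
    then have "I = P" "I = Q"
      using subspace_eqI[OF I P'(1)] subspace_eqI[OF I Q'(1)] P'(3) Q'(2) by (auto simp: I_def)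
    then show "P = Q" by simp
  qed
  obtain a where a: "a \<in> M" "a \<noteq> \<zero>"
    using \<open>atom M\<close> subspaceD(2)[of M] by (auto simp: atom_def F_def)
  have ac: "a \<in> carrier R"
    using a \<open>atom M\<close> subspaceD(1)[of M] by (auto simp: atom_def F_def)
  \<comment> \<open>Scaling by \<open>inv a\<close> turns \<open>M\<close> into an atom that
    contains \<open>\<one>\<close>.\<close>
  define H where "H = (\<otimes>) (inv a) ` M"
  have "atom H"
    unfolding H_def by (intro atom_smult \<open>atom M\<close> inv_nonzero ac a)
  then have H: "subspace H" "span_mult H S \<noteq> carrier R" "vdim (span_mult H S) = \<kappa> + vdim H"
    using fp by (auto simp: atom_def F_def)
  note Hc = subspaceD(1)[OF H(1)]
  have "inv a \<otimes> a = \<one>"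
    using ac a(2) field_Units by simp
  then have oneH: "\<one> \<in> H"
    using a(1) unfolding H_def by (metis imageI)
  \<comment> \<open>The scaled set is again an atom, and it shares \<open>\<one>\<close> with
    \<open>H\<close>.\<close>
  have stable: "(\<otimes>) (inv x) ` H = H" if x: "x \<in> H" "x \<noteq> \<zero>" for x
  proof -
    have xc: "x \<in> carrier R" using x Hc by auto
    have "inv x \<otimes> x = \<one>" using xc x field_Units by simp
    then have "\<one> \<in> (\<otimes>) (inv x) ` H" using x(1) by (metis imageI)
    then have "(\<otimes>) (inv x) ` H \<inter> H \<noteq> {\<zero>}"
      using oneH one_not_zero by blast
    then show ?thesis
      by (intro atoms_eq atom_smult \<open>atom H\<close> inv_nonzero xc x)
  qed
  have inv_H: "inv x \<in> H" if "x \<in> H" "x \<noteq> \<zero>" for x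
  proof -
    have "inv x \<otimes> \<one> \<in> H" using stable[OF that] oneH by blast
    then show ?thesis using inv_nonzero(1)[of x] that Hc by auto
  qed
  have mult_H: "x \<otimes> y \<in> H" if "x \<in> H" "y \<in> H" for x y
  proof (cases "x = \<zero>")
    case True
    then show ?thesis using that Hc subspaceD(2)[OF H(1)] by auto
  next
    case False
    have xc: "x \<in> carrier R" using that Hc by auto
    have "(\<otimes>) x ` H = (\<otimes>) x ` (\<otimes>) (inv x) ` H"
      using stable[OF that(1) False] by simp
    also have "\<dots> = H" by (rule smult_inv_image(2)[OF xc False Hc])
    finally show ?thesis using that(2) by blast
  qed
  have KH: "K \<subseteq> H"
  proof
    fix k assume k: "k \<in> K"
    then have "k \<otimes> \<one> \<in> H" using subspaceD(4)[OF H(1) k oneH] by simp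
    then show "k \<in> H" using subsetD[OF K_subset k] by simp
  qed
  have "subfield H R"
  proof (rule subfieldI')
    have "\<ominus> x \<in> H" if "x \<in> H" for x
      using that H(1) subgroup.m_inv_closed[of H "add_monoid R" x]
      by (simp add: subalgebra_def a_inv_def)
    then show "subring H R"
      using Hc oneH mult_H subspaceD(3)[OF H(1)] by (intro subringI) auto
  qed (use inv_H in auto)
  moreover have "vdim (span_mult H S) + vdim P0 \<le> vdim (span_mult P0 S) + vdim H"
    using H(3) fp[OF P0(1)] min_f[OF \<open>F P0\<close>] by simp
  ultimately show ?thesis using KH H(2) by blast
qed

text \<open>
  A linear analogue of Chowla's theorem on sumsets: no nonzero element of \<open>T\<close> lies in the
  proper subfield supplied by the isoperimetric method for \<open>S = K \<oplus> T\<close>.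
\<close>

lemma vdim_add_le_of_mult_subset:
  assumes A: "subspace A" "A \<noteq> carrier R"
    and P: "subspace P" "P \<noteq> {\<zero>}" "P \<subseteq> A"
    and T: "subspace T" "\<And>b. b \<in> T \<Longrightarrow> b \<noteq> \<zero> \<Longrightarrow> generate_field R (insert b K) = carrier R"
    and PT: "\<And>x t. x \<in> P \<Longrightarrow> t \<in> T \<Longrightarrow> x \<otimes> t \<in> A"
  shows "vdim P + vdim T \<le> vdim A"
proof -
  have K: "subspace K" by (rule subfield_subspace[OF subfield_K subset_refl])
  \<comment> \<open>Adding \<open>K\<close> puts \<open>\<one>\<close> into \<open>S\<close>, as
    \<open>atom_subfield\<close> requires; \<open>PS\<close> stays inside \<open>A\<close> because
    \<open>P\<close> does.\<close>
  define S where "S = K <+>\<^bsub>R\<^esub> T"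
  have S: "subspace S" unfolding S_def by (rule subspace_sum[OF K T(1)])
  have oneS: "\<one> \<in> S"
    using subset_sum(1)[OF K T(1)] subringE(3)[OF subfieldE(1)[OF subfield_K]] by (auto simp: S_def)
  note Pc = subspaceD(1)[OF P(1)] and Tc = subspaceD(1)[OF T(1)] and Sc = subspaceD(1)[OF S]
  have PS: "span_mult P S \<subseteq> A"
  proof (rule span_mult_least[OF A(1)])
    fix x s assume x: "x \<in> P" and "s \<in> S"
    then obtain k t where kt: "k \<in> K" "t \<in> T" "s = k \<oplus> t" by (auto simp: S_def mem_sum_iff)
    have "x \<otimes> s = k \<otimes> x \<oplus> x \<otimes> t"
      using subsetD[OF Pc x] subsetD[OF K_subset kt(1)] subsetD[OF Tc kt(2)] kt(3)
      by (simp add: r_distr m_comm)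
    then show "x \<otimes> s \<in> A"
      using subspaceD(3)[OF A(1) subspaceD(4)[OF A(1) kt(1) subsetD[OF P(3) x]] PT[OF x kt(2)]] by simp
  qed
  then have "span_mult P S \<noteq> carrier R"
    using A subspaceD(1)[OF A(1)] by blast
  then obtain H where H: "subfield H R" "K \<subseteq> H" "span_mult H S \<noteq> carrier R"
    "vdim (span_mult H S) + vdim P \<le> vdim (span_mult P S) + vdim H"
    using atom_subfield[OF S oneS P(1,2)] by blast
  have Hs: "subspace H" by (rule subfield_subspace[OF H(1,2)])
  note Hc = subspaceD(1)[OF Hs]
  have HS: "subspace (span_mult H S)" by (rule subspace_span_mult[OF Hc Sc])
  have HHS: "H \<subseteq> span_mult H S" by (rule span_mult_incl[OF Hc Sc oneS])
  have "b = \<zero>" if "b \<in> H" "b \<in> T" for b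
  proof (rule ccontr)
    assume "b \<noteq> \<zero>"
    then have "carrier R = generate_field R (insert b K)" using T(2) that(2) by simp
    also have "\<dots> \<subseteq> H"
      by (rule generate_field_min_subfield1) (use that H(1,2) subsetD[OF Hc] K_subset in auto)
    \<comment> \<open>\<open>H\<close> is a proper subfield, since it lies in the proper subspace
      \<open>HS\<close>.\<close>
    finally show False using HHS H(3) subspaceD(1)[OF HS] by blast
  qed
  then have "H \<inter> T = {\<zero>}"
    using subspaceD(2)[OF Hs] subspaceD(2)[OF T(1)] by blast
  then have sum: "vdim (H <+>\<^bsub>R\<^esub> T) = vdim H + vdim T"
    using vdim_modular[OF Hs T(1)] by simp
  have "T \<subseteq> span_mult H S"
  proof
    fix t assume t: "t \<in> T"
    then have "t \<in> S" using subset_sum(2)[OF K T(1)] by (auto simp: S_def)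
    moreover have "\<one> \<in> H" by (rule subringE(3)[OF subfieldE(1)[OF H(1)]])
    ultimately have "\<one> \<otimes> t \<in> span_mult H S" by (intro mem_span_mult)
    then show "t \<in> span_mult H S" using subsetD[OF Tc t] by simp
  qed
  then have "vdim (H <+>\<^bsub>R\<^esub> T) \<le> vdim (span_mult H S)"
    by (intro vdim_mono subspace_sum Hs T HS sum_least HHS)
  moreover have "vdim (span_mult P S) \<le> vdim A"
    by (rule vdim_mono[OF subspace_span_mult[OF Pc Sc] A(1) PS])
  \<comment> \<open>Both \<open>H\<close> and \<open>T\<close> lie in \<open>HS\<close>, so
    \<open>dim H + dim T \<le> dim HS\<close>, and
    \<open>dim HS + dim P \<le> dim PS + dim H\<close>. Now \<open>dim H\<close> cancels.\<close>
  ultimately show ?thesis using sum H(4) by simp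
qed

section \<open>Hyperplanes from Hall's condition, and vectors dual to them\<close>

lemma subspace_line_extension:
  assumes "subspace E" "x \<in> carrier R" "x \<notin> E"
  shows "subspace (line_extension K x E)" "vdim (line_extension K x E) = Suc (vdim E)"
    and "x \<in> line_extension K x E" "E \<subseteq> line_extension K x E"
proof -
  have dim: "dimension (Suc (vdim E)) K (line_extension K x E)"
    by (rule Suc_dim[OF assms(2,3) dimension_vdim[OF assms(1)]])
  then show "subspace (line_extension K x E)" "vdim (line_extension K x E) = Suc (vdim E)"
    by (rule subspace_dimension, rule vdimI)
  note Ec = subspaceD(1)[OF assms(1)]
  have "x = \<one> \<otimes> x \<oplus> \<zero>" using assms(2) by simp
  then show "x \<in> line_extension K x E"
    using subspaceD(2)[OF assms(1)] subringE(3)[OF subfieldE(1)[OF subfield_K]]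
    unfolding line_extension_mem_iff by blast
  show "E \<subseteq> line_extension K x E"
  proof
    fix e assume e: "e \<in> E"
    then have "e = \<zero> \<otimes> x \<oplus> e" using assms(2) subsetD[OF Ec e] by simp
    then show "e \<in> line_extension K x E"
      using e subringE(2)[OF subfieldE(1)[OF subfield_K]] unfolding line_extension_mem_iff by blast
  qed
qed

lemma line_extension_least:
  assumes "subspace Z" "x \<in> Z" "E \<subseteq> Z"
  shows "line_extension K x E \<subseteq> Z"
proof
  fix y assume "y \<in> line_extension K x E"
  then obtain k e where "k \<in> K" "e \<in> E" "y = k \<otimes> x \<oplus> e" by (auto simp: line_extension_mem_iff)
  then show "y \<in> Z"
    using subspaceD(3)[OF assms(1) subspaceD(4)[OF assms(1) \<open>k \<in> K\<close> assms(2)] subsetD[OF assms(3)]]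
    by simp
qed

text \<open>Codimension two leaves room for two directions \<open>x\<close> and \<open>y\<close>
  independent modulo \<open>E\<close>. The sum of the extensions then has dimension at least
  \<open>vdim E + 2\<close>, and modularity leaves only \<open>E\<close> for their
  intersection.\<close>

lemma exists_two_line_extensions:
  assumes "subspace B" "subspace E" "E \<subseteq> B" "vdim E + 2 \<le> vdim B"
  shows "\<exists>V W. subspace V \<and> subspace W \<and> V \<subseteq> B \<and> W \<subseteq> B \<and> E \<subset> V \<and> E \<subset> W \<and> V \<inter> W = E"
proof -
  note Bc = subspaceD(1)[OF assms(1)]
  have "E \<noteq> B" using assms(4) by auto
  then obtain x where x: "x \<in> B" "x \<notin> E" using assms(3) by blast
  define V where "V = line_extension K x E"
  note V = subspace_line_extension[OF assms(2) subsetD[OF Bc x(1)] x(2), folded V_def]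
  have VB: "V \<subseteq> B" unfolding V_def by (rule line_extension_least[OF assms(1) x(1) assms(3)])
  have "V \<noteq> B" using assms(4) V(2) by auto
  then obtain y where y: "y \<in> B" "y \<notin> V" using VB by blast
  have "y \<notin> E" using y V(4) by blast
  define W where "W = line_extension K y E"
  note W = subspace_line_extension[OF assms(2) subsetD[OF Bc y(1)] \<open>y \<notin> E\<close>, folded W_def]
  have WB: "W \<subseteq> B" unfolding W_def by (rule line_extension_least[OF assms(1) y(1) assms(3)])
  note VW = subspace_sum[OF V(1) W(1)] subset_sum[OF V(1) W(1)]
  have "line_extension K y V \<subseteq> V <+>\<^bsub>R\<^esub> W"
    by (rule line_extension_least[OF VW(1) subsetD[OF VW(3) W(3)] VW(2)])
  then have "vdim (line_extension K y V) \<le> vdim (V <+>\<^bsub>R\<^esub> W)"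
    by (rule vdim_mono[OF subspace_line_extension(1)[OF V(1) subsetD[OF Bc y(1)] y(2)] VW(1)])
  then have "vdim (V \<inter> W) \<le> vdim E"
    using subspace_line_extension(2)[OF V(1) subsetD[OF Bc y(1)] y(2)] vdim_modular[OF V(1) W(1)]
      V(2) W(2) by simp
  then have "E = V \<inter> W"
    using V(4) W(4) by (intro subspace_eqI subalgebra_inter assms(2) V(1) W(1)) auto
  then show ?thesis
    using V(1,3,4) W(1,3,4) VB WB x(2) \<open>y \<notin> E\<close> by blast
qed

text \<open>
  Dual form of Rado's theorem on independent transversals. A family of largest total dimension
  that satisfies Hall's condition consists of hyperplanes: two different enlargements
  of one member would both violate the condition, which contradicts modularity.
\<close>

lemma hall_hyperplanes:
  assumes B: "subspace B"
    and V: "\<And>i. i < vdim B \<Longrightarrow> subspace (V i) \<and> V i \<subseteq> B"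
    and hall: "\<And>J. J \<subseteq> {..<vdim B} \<Longrightarrow> vdim (B \<inter> (\<Inter>i\<in>J. V i)) + card J \<le> vdim B"
  shows "\<exists>H. (\<forall>i<vdim B. subspace (H i) \<and> V i \<subseteq> H i \<and> H i \<subseteq> B \<and> vdim (H i) + 1 = vdim B) \<and>
    B \<inter> (\<Inter>i\<in>{..<vdim B}. H i) = {\<zero>}"
proof -
  define n where "n = vdim B"
  define N where "N H J = B \<inter> (\<Inter>i\<in>J. H i)" for H :: "nat \<Rightarrow> 'a set" and J
  define good where "good H \<longleftrightarrow> (\<forall>i<n. subspace (H i) \<and> V i \<subseteq> H i \<and> H i \<subseteq> B) \<and>
    (\<forall>J\<subseteq>{..<n}. vdim (N H J) + card J \<le> n)" for H
  define g where "g H = (\<Sum>i<n. vdim (H i))" for H :: "nat \<Rightarrow> 'a set"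
  have "good V" using V hall by (auto simp: good_def N_def n_def)
  \<comment> \<open>The total dimension is bounded, so a good family maximising it exists.\<close>
  moreover have "\<forall>H. good H \<longrightarrow> g H < Suc (n * n)"
  proof (intro allI impI)
    fix H assume "good H"
    then have "vdim (H i) \<le> n" if "i < n" for i
      using vdim_mono[OF _ B] that by (auto simp: good_def n_def)
    then have "g H \<le> (\<Sum>i<n. n)" unfolding g_def by (intro sum_mono) auto
    then show "g H < Suc (n * n)" by simp
  qed
  ultimately obtain H where H: "good H" and max: "\<And>H'. good H' \<Longrightarrow> g H' \<le> g H"
    using ex_has_greatest_nat[of good V g "Suc (n * n)"] by (metis nat_less_le)
  have Hs: "subspace (H i)" "V i \<subseteq> H i" "H i \<subseteq> B" if "i < n" for i
    using H that by (auto simp: good_def)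
  have hallH: "vdim (N H J) + card J \<le> n" if "J \<subseteq> {..<n}" for J
    using H that by (auto simp: good_def)
  have Ns: "subspace (N H J)" if "J \<subseteq> {..<n}" for J
    unfolding N_def using Hs(1) that by (intro subspace_INT B) auto
  \<comment> \<open>By maximality, enlarging \<open>H i\<close> to \<open>W\<close> breaks Hall's
    condition for some set, which must contain \<open>i\<close>. Stating this with \<open>i\<close>
    removed from the set turns \<open>n <\<close> into \<open>n \<le>\<close>.\<close>
  have violation: "\<exists>J\<subseteq>{..<n} - {i}. n \<le> vdim (W \<inter> N H J) + card J"
    if i: "i < n" and W: "subspace W" "W \<subseteq> B" "H i \<subset> W" for i W
  proof -
    define H' where "H' = H(i := W)"
    have "vdim (H i) < vdim W"
      using subspace_eqI[OF Hs(1)[OF i] W(1)] W(3) by (cases "vdim W \<le> vdim (H i)") auto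
    then have "g H < g H'"
      unfolding g_def H'_def using i W vdim_mono by (intro sum_strict_mono_ex1) auto
    then have "\<not> good H'" using max[of H'] by auto
    moreover have "\<forall>j<n. subspace (H' j) \<and> V j \<subseteq> H' j \<and> H' j \<subseteq> B"
      using Hs W(1,2) subset_trans[OF Hs(2)[OF i] psubset_imp_subset[OF W(3)]] by (simp add: H'_def)
    ultimately obtain J where J: "J \<subseteq> {..<n}" "n < vdim (N H' J) + card J"
      unfolding good_def by (meson not_le)
    have "i \<in> J"
    proof (rule ccontr)
      assume "i \<notin> J"
      then have "N H' J = N H J" unfolding N_def H'_def by (intro arg_cong2[of _ _ _ _ "(\<inter>)"] INF_cong) auto
      then show False using hallH[OF J(1)] J(2) by simp
    qed
    have "N H' J = W \<inter> N H (J - {i})"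
      using \<open>i \<in> J\<close> W(2) by (auto simp: N_def H'_def)
    moreover have "card J = Suc (card (J - {i}))"
      using card.remove[OF finite_subset[OF J(1)] \<open>i \<in> J\<close>] by simp
    ultimately show ?thesis using J by (intro exI[of _ "J - {i}"]) auto
  qed
  have hyp: "vdim (H i) + 1 = n" if i: "i < n" for i
  proof (rule ccontr)
    assume neq: "vdim (H i) + 1 \<noteq> n"
    have "N H {i} = H i" using Hs(3)[OF i] by (auto simp: N_def)
    then have "vdim (H i) + 2 \<le> vdim B" using hallH[of "{i}"] i neq by (simp add: n_def)
    then obtain W1 W2 where W: "subspace W1" "subspace W2" "W1 \<subseteq> B" "W2 \<subseteq> B"
      "H i \<subset> W1" "H i \<subset> W2" "W1 \<inter> W2 = H i"
      using exists_two_line_extensions[OF B Hs(1,3)[OF i]] by blast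
    obtain J1 where J1: "J1 \<subseteq> {..<n} - {i}" "n \<le> vdim (W1 \<inter> N H J1) + card J1"
      using violation[OF i W(1,3,5)] by blast
    obtain J2 where J2: "J2 \<subseteq> {..<n} - {i}" "n \<le> vdim (W2 \<inter> N H J2) + card J2"
      using violation[OF i W(2,4,6)] by blast
    have sub: "J1 \<subseteq> {..<n}" "J2 \<subseteq> {..<n}" "J1 \<inter> J2 \<subseteq> {..<n}" "insert i (J1 \<union> J2) \<subseteq> {..<n}"
      using J1 J2 i by auto
    have fin: "finite J1" "finite J2"
      using sub finite_subset by blast+
    have i_notin: "i \<notin> J1 \<union> J2" using J1 J2 by blast
    define P where "P = W1 \<inter> N H J1"
    define Q where "Q = W2 \<inter> N H J2"
    have PQ: "subspace P" "subspace Q"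
      unfolding P_def Q_def by (intro subalgebra_inter W Ns sub)+
    have "P <+>\<^bsub>R\<^esub> Q \<subseteq> N H (J1 \<inter> J2)"
      by (rule sum_least[OF Ns[OF sub(3)]]) (auto simp: P_def Q_def N_def)
    then have "vdim (P <+>\<^bsub>R\<^esub> Q) \<le> vdim (N H (J1 \<inter> J2))"
      by (rule vdim_mono[OF subspace_sum[OF PQ] Ns[OF sub(3)]])
    moreover have "P \<inter> Q = N H (insert i (J1 \<union> J2))"
      using W(7) by (auto simp: P_def Q_def N_def)
    moreover have "card (insert i (J1 \<union> J2)) = Suc (card (J1 \<union> J2))"
      using fin i_notin by simp
    \<comment> \<open>The two violations add up to at least \<open>2 * n\<close>. Modularity for
      \<open>P\<close>, \<open>Q\<close> and for the index sets bounds the same total by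
      \<open>2 * n - 1\<close>, the loss of one being due to the extra index
      \<open>i\<close>.\<close>
    ultimately show False
      using vdim_modular[OF PQ] hallH[OF sub(3)] hallH[OF sub(4)] J1(2) J2(2) card_Un_Int[OF fin]
      by (simp add: P_def Q_def)
  qed
  \<comment> \<open>For the full index set, Hall's condition leaves no room for a positive
    dimension.\<close>
  have "vdim (N H {..<n}) = 0" using hallH[of "{..<n}"] by simp
  then have "N H {..<n} = {\<zero>}" using vdim_pos_iff[OF Ns[of "{..<n}"]] by simp
  then show ?thesis
    using Hs hyp by (intro exI[of _ H]) (auto simp: n_def N_def)
qed

text \<open>Each hyperplane costs at most one dimension, so any \<open>n - 1\<close> of them share a
  nonzero vector. The zero total intersection keeps it out of the remaining one.\<close>

lemma basis_from_hyperplanes: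
  assumes B: "subspace B"
    and H: "\<And>i. i < vdim B \<Longrightarrow> subspace (H i) \<and> H i \<subseteq> B \<and> vdim (H i) + 1 = vdim B"
    and zero: "B \<inter> (\<Inter>i\<in>{..<vdim B}. H i) = {\<zero>}"
  shows "\<exists>b. \<forall>i<vdim B. b i \<in> B \<and> b i \<notin> H i \<and> (\<forall>j<vdim B. j \<noteq> i \<longrightarrow> b i \<in> H j)"
proof -
  define n where "n = vdim B"
  define N where "N J = B \<inter> (\<Inter>i\<in>J. H i)" for J
  have Ns: "subspace (N J)" if "J \<subseteq> {..<n}" for J
    unfolding N_def using H that by (intro subspace_INT B) (auto simp: n_def)
  have lower: "n \<le> vdim (N J) + card J" if "finite J" "J \<subseteq> {..<n}" for J
    using that
  proof (induction J rule: finite_induct)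
    case empty
    then show ?case by (simp add: N_def n_def)
  next
    case (insert j J)
    then have j: "j < vdim B" "J \<subseteq> {..<n}" by (auto simp: n_def)
    have "N (insert j J) = N J \<inter> H j" by (auto simp: N_def)
    moreover have "vdim (N J) + vdim (H j) \<le> vdim (N J \<inter> H j) + vdim B"
      using H[OF j(1)] by (intro vdim_inter_ge Ns j(2) B) (auto simp: N_def)
    moreover have "vdim (H j) + 1 = vdim B" using H[OF j(1)] by simp
    ultimately show ?case
      using insert.IH[OF j(2)] insert.hyps by (simp add: n_def)
  qed
  have "\<exists>b. b \<in> B \<and> b \<notin> H i \<and> (\<forall>j<n. j \<noteq> i \<longrightarrow> b \<in> H j)" if i: "i < n" for i
  proof -
    define J where "J = {..<n} - {i}"
    have J: "J \<subseteq> {..<n}" "finite J" "card J + 1 = n" using i by (auto simp: J_def)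
    have "0 < vdim (N J)" using lower[OF J(2,1)] J(3) by simp
    then have "N J \<noteq> {\<zero>}" using vdim_pos_iff[OF Ns[OF J(1)]] by simp
    then obtain b where b: "b \<in> N J" "b \<noteq> \<zero>"
      using subspaceD(2)[OF Ns[OF J(1)]] by blast
    have "b \<notin> H i"
    proof
      assume "b \<in> H i"
      then have "b \<in> B \<inter> (\<Inter>i\<in>{..<vdim B}. H i)" using b(1) by (auto simp: N_def J_def n_def)
      then show False using b(2) unfolding zero by simp
    qed
    moreover have "b \<in> B" "\<forall>j<n. j \<noteq> i \<longrightarrow> b \<in> H j"
      using b(1) by (auto simp: N_def J_def)
    ultimately show ?thesis by blast
  qed
  then have "\<forall>i. \<exists>b. i < n \<longrightarrow> b \<in> B \<and> b \<notin> H i \<and> (\<forall>j<n. j \<noteq> i \<longrightarrow> b \<in> H j)" by simp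
  from choice[OF this] show ?thesis unfolding n_def by simp
qed

section \<open>Construction of the matched basis\<close>

lemma independent_nths: "independent K us \<Longrightarrow> independent K (nths us J)"
proof (induction us arbitrary: J)
  case Nil
  then show ?case by simp
next
  case (Cons u us)
  note u = independent_backwards[OF Cons.prems]
  have "Span K (nths us {j. Suc j \<in> J}) \<subseteq> Span K us"
    by (rule mono_Span_sublist[OF subfield_K set_nths_subset independent_in_carrier[OF u(2)]])
  then have "u \<notin> Span K (nths us {j. Suc j \<in> J})"
    using u(1) by blast
  then show ?case
    using Cons.IH[OF u(2)] li_Cons[OF u(3)] by (auto simp: nths_Cons)
qed

lemma exists_matched_basis:
  assumes A: "subspace A" "A \<noteq> carrier R" and B: "subspace B" "vdim A = vdim B"
    and prim: "\<And>b. b \<in> B \<Longrightarrow> b \<noteq> \<zero> \<Longrightarrow> generate_field R (insert b K) = carrier R"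
    and as: "basis_of K A as"
  shows "\<exists>bs. basis_of K B bs \<and> matched_basis K A B as bs"
proof -
  define n where "n = vdim B"
  note Ac = subspaceD(1)[OF A(1)] and Bc = subspaceD(1)[OF B(1)]
  have as': "set as \<subseteq> carrier R" "independent K as" "Span K as = A"
    using as by (auto simp: basis_of_def)
  have len: "length as = n"
    using vdimI[OF dimensionI[OF subfield_K as'(2,3)]] B(2) by (simp add: n_def)
  \<comment> \<open>Here \<open>A\<close> takes the place of the hyperplane:
    \<open>dual A {a}\<close> is just the subspace of all \<open>y\<close> with
    \<open>y \<otimes> a \<in> A\<close>.\<close>
  define V where "V i = B \<inter> dual A {as ! i}" for i
  have asc: "as ! i \<in> carrier R" if "i < n" for i
    using as'(1) len that by auto
  have mem_V: "b \<in> V i \<longleftrightarrow> b \<in> B \<and> as ! i \<otimes> b \<in> A" if "i < n" for i b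
    using asc[OF that] Bc by (auto simp: V_def dual_def m_comm subset_iff)
  have V: "subspace (V i)" "V i \<subseteq> B" if "i < n" for i
    unfolding V_def using asc[OF that] by (auto intro!: subalgebra_inter B(1) subspace_dual A(1))
  have hall: "vdim (B \<inter> (\<Inter>i\<in>J. V i)) + card J \<le> n" if J: "J \<subseteq> {..<n}" for J
  \<comment> \<open>For empty \<open>J\<close> the span \<open>P\<close> is zero, which
    \<open>vdim_add_le_of_mult_subset\<close> excludes.\<close>
  proof (cases "J = {}")
    case True
    then show ?thesis by (simp add: n_def)
  next
    case False
    have fin: "finite J" using J finite_subset by blast
    define us where "us = nths as J"
    define P where "P = Span K us"
    define T where "T = B \<inter> (\<Inter>i\<in>J. V i)"
    have us: "independent K us" unfolding us_def by (rule independent_nths[OF as'(2)])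
    have usA: "set us \<subseteq> A"
      using Span_base_incl[OF subfield_K as'(1)] as'(3) set_nths_subset[of as J] by (auto simp: us_def)
    have Ps: "subspace P"
      unfolding P_def by (rule Span_is_subalgebra[OF subfield_K independent_in_carrier[OF us]])
    have "{i. i < length as \<and> i \<in> J} = J" using J len by auto
    then have dimP: "vdim P = card J"
      using vdimI[OF dimension_independent[OF us]] by (simp add: P_def us_def length_nths)
    then have P0: "P \<noteq> {\<zero>}" using vdim_pos_iff[OF Ps] False fin by (simp add: card_gt_0_iff)
    have PA: "P \<subseteq> A"
      unfolding P_def by (rule subalgebra_Span_incl[OF subfield_K A(1) usA])
    have Ts: "subspace T" unfolding T_def using V(1) J by (intro subspace_INT B(1)) auto
    have "x \<otimes> t \<in> A" if x: "x \<in> P" and t: "t \<in> T" for x t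
    proof -
      have tc: "{t} \<subseteq> carrier R" using t Bc by (auto simp: T_def)
      \<comment> \<open>For fixed \<open>t\<close> the condition on \<open>x\<close> is linear, so
        it need only be checked on the generators of \<open>P\<close>.\<close>
      have "u \<in> dual A {t}" if u: "u \<in> set us" for u
      proof -
        obtain i where i: "i < n" "i \<in> J" "u = as ! i"
          using u len by (auto simp: us_def set_nths)
        then have "t \<in> V i" using t by (auto simp: T_def)
        then show ?thesis using mem_V[OF i(1)] i(3) asc[OF i(1)] by (simp add: dual_def)
      qed
      then have "P \<subseteq> dual A {t}"
        unfolding P_def
        by (intro subalgebra_Span_incl[OF subfield_K subspace_dual[OF A(1) tc]]) auto
      then show ?thesis using x by (auto simp: dual_def)
    qed
    then have "vdim P + vdim T \<le> vdim A"
      using prim by (intro vdim_add_le_of_mult_subset A Ps P0 PA Ts) (auto simp: T_def)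
    then show ?thesis using dimP B(2) by (simp add: T_def n_def)
  qed
  obtain H where H: "\<And>i. i < n \<Longrightarrow> subspace (H i) \<and> V i \<subseteq> H i \<and> H i \<subseteq> B \<and> vdim (H i) + 1 = n"
    and H0: "B \<inter> (\<Inter>i\<in>{..<n}. H i) = {\<zero>}"
    using hall_hyperplanes[OF B(1), of V] V hall unfolding n_def by blast
  obtain b where b: "\<And>i. i < n \<Longrightarrow> b i \<in> B \<and> b i \<notin> H i \<and> (\<forall>j<n. j \<noteq> i \<longrightarrow> b i \<in> H j)"
    using basis_from_hyperplanes[OF B(1), of H] H H0 unfolding n_def by blast
  \<comment> \<open>All \<open>b i\<close> with \<open>i \<noteq> j\<close> lie in
    \<open>H j\<close>, but \<open>b j\<close> does not. Arbitrary lists of distinct indices are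
    allowed because the claim serves both for \<open>bs\<close> and for \<open>bs\<close> with one
    entry omitted.\<close>
  have ind: "independent K (map b js)" if "distinct js" "set js \<subseteq> {..<n}" for js
    using that
  proof (induction js)
    case Nil
    then show ?case by simp
  next
    case (Cons j js)
    then have j: "j < n" "set js \<subseteq> {..<n}" "j \<notin> set js" "distinct js" by auto
    have "set (map b js) \<subseteq> H j" using b j by auto
    then have "Span K (map b js) \<subseteq> H j"
      using H[OF j(1)] by (intro subalgebra_Span_incl[OF subfield_K]) auto
    then have "b j \<notin> Span K (map b js)" using b[OF j(1)] by blast
    then show ?case
      using li_Cons[OF subsetD[OF Bc]] b[OF j(1)] Cons.IH[OF j(4,2)] by simp
  qed
  define bs where "bs = map b [0..<n]"
  have bsB: "set bs \<subseteq> B" using b by (auto simp: bs_def)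
  have ind_bs: "independent K bs" unfolding bs_def by (rule ind) auto
  have "Span K bs = B"
    using independent_length_eq_dimension[OF subfield_K dimension_vdim[OF B(1)] ind_bs bsB]
    by (simp add: bs_def n_def)
  then have "basis_of K B bs"
    using bsB Bc ind_bs by (auto simp: basis_of_def)
  moreover have "matched_basis K A B as bs"
    unfolding matched_basis_def
  proof (intro conjI ballI allI impI)
    show "length as = length bs" using len by (simp add: bs_def)
    fix x i assume x: "x \<in> B" "as ! i \<otimes> x \<in> A" and "i < length as"
    then have i: "i < n" using len by simp
    define js where "js = take i [0..<n] @ drop (Suc i) [0..<n]"
    have js: "set js = {..<n} - {i}" "distinct js" "length js + 1 = n"
      using i by (auto simp: js_def)
    have bs_js: "take i bs @ drop (Suc i) bs = map b js"
      by (simp add: bs_def js_def take_map drop_map)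
    have Hi: "subspace (H i)" "vdim (H i) + 1 = n" using H[OF i] by auto
    have "set (map b js) \<subseteq> H i" using b i js(1) by auto
    \<comment> \<open>These are \<open>n - 1\<close> independent vectors in a space of dimension
      \<open>n - 1\<close>. Matching then follows from \<open>V i \<subseteq> H i\<close>.\<close>
    then have "Span K (map b js) = H i"
      using independent_length_eq_dimension[OF subfield_K dimension_vdim[OF Hi(1)] ind[OF js(2)]]
        js Hi(2) by auto
    moreover have "x \<in> V i" using mem_V[OF i] x by simp
    ultimately show "x \<in> Span K (take i bs @ drop (Suc i) bs)"
      using H[OF i] by (auto simp: bs_js)
  qed
  ultimately show ?thesis by blast
qed

end

section \<open>Reduction to a finite extension with \<open>A\<close> proper\<close>

theorem theorem4p2:
  fixes L :: "('a, 'b) ring_scheme" (structure)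
    and K A B :: "'a set" and n :: nat
  assumes "field L" and "subfield K L" and "K \<subset> carrier L"
    and "field.separable_extension L K"
    and "n \<ge> 1"
    and "ring.dimension L n K A" and "ring.dimension L n K B"
    and "ring.primitive_subspace L K B"
  shows "ring.matched_subspace L K A B"
proof -
  interpret field L by fact
  have "subalgebra K B L"
    using finite_dimension_imp_subalgebra[OF assms(2) finite_dimensionI[OF assms(7)]] .
  then have Bc: "B \<subseteq> carrier L" by (rule subalgebra_in_carrier)
  have prim: "generate_field L (insert b K) = carrier L" if "b \<in> B" "b \<noteq> \<zero>" for b
    using assms(8) that by (simp add: primitive_subspace_def)
  have "B \<noteq> {\<zero>}"
    using assms(5) dimension_is_inj[OF assms(2,7), of 0] by auto
  then obtain b where b: "b \<in> B" "b \<noteq> \<zero>"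
    using space_subgroup_props(2)[OF assms(2,7)] by blast
  then have bc: "b \<in> carrier L" using Bc by blast
  have alg: "(algebraic over K) b"
    using assms(4) bc by (simp add: separable_extension_def)
  \<comment> \<open>Since \<open>b\<close> is algebraic, the ring \<open>K[b]\<close> is already a
    field, so it contains \<open>K(b)\<close>, which is \<open>L\<close> by primitivity.\<close>
  have "generate_field L (insert b K) \<subseteq> simple_extension K b"
    using simple_extension_is_subfield[OF assms(2) bc] alg subfieldE(3)[OF assms(2)] bc
      simple_extension_mem[OF subfieldE(1)[OF assms(2)] bc] simple_extension_incl[OF _ bc]
    by (intro generate_field_min_subfield1) auto
  then have "simple_extension K b = carrier L"
    using prim[OF b] simple_extension_in_carrier[OF subfieldE(3)[OF assms(2)] bc] by blast
  then have "finite_dimension K (carrier L)"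
    using finite_dimension_simple_extension[OF assms(2) bc] alg by simp
  then interpret finite_field_extension K L
    by (intro finite_field_extension.intro finite_field_extension_axioms.intro field_axioms assms(2))
  have A: "subalgebra K A L" "vdim A = n" and B: "subalgebra K B L" "vdim B = n"
    using subspace_dimension vdimI assms(6,7) by blast+
  \<comment> \<open>Otherwise \<open>B\<close> is also \<open>L\<close> by dimension, and
    primitivity at \<open>\<one> \<in> B\<close> gives \<open>L = K(1) = K\<close>, against
    properness of the extension.\<close>
  have "A \<noteq> carrier L"
  proof
    assume "A = carrier L"
    then have "B = carrier L"
      using subspace_eqI[OF B(1) subspace_carrier Bc] A(2) B(2) by simp
    then have "carrier L = generate_field L (insert \<one> K)" using prim[of \<one>] by simp
    also have "\<dots> \<subseteq> K"
      using subringE(3)[OF subfieldE(1)[OF assms(2)]] subfieldE(3)[OF assms(2)]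
      by (intro generate_field_min_subfield1 assms(2)) auto
    finally show False using assms(3) by blast
  qed
  then show ?thesis
    using exists_matched_basis[OF A(1) _ B(1) _ prim] A(2) B(2)
    by (simp add: matched_subspace_def)
qed

end
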